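(* The function $(\theta_1,\theta_2)\mapsto\sqrt{D_{\mathrm{Bhat}}(p_{\theta_1}:p_{\theta_2})}$ is a distance (metric) on $\mathbb{H}$.
   Context: $\mathbb{H}=\{z\in\mathbb{C}:\operatorname{Im}z>0\}$. For $\theta\in\mathbb{H}$, $p_\theta(x)=\frac{\operatorname{Im}\theta}{\pi|x-\theta|^2}$, $x\in\mathbb{R}$, is the Cauchy density. The Bhattacharyya divergence is $D_{\mathrm{Bhat}}(p:q):=-\log\left(\int_{\mathbb{R}}\sqrt{p(x)q(x)}\,dx\right)$. *)

theory Defs
  imports "HOL-Analysis.Analysis"
begin

definition upper_half_plane :: "complex set" where
  "upper_half_plane = {z. Im z > 0}"

definition cauchy_density :: "complex \<Rightarrow> real \<Rightarrow> real" where
  "cauchy_density \<theta> x = Im \<theta> / (pi * (cmod (complex_of_real x - \<theta>))\<^sup>2)"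

text \<open>
  Adequate when the densities satisfy \<^prop>\<open>(LINT x|lborel. sqrt (p x * q x)) > 0\<close>.
  If the integral vanishes, \<^prop>\<open>ln (0::real) = 0\<close> gives the value \<open>0\<close> instead of infinity;
  this does not occur for Cauchy densities with parameters in the upper half plane, which are
  continuous and positive.
\<close>

definition bhattacharyya_divergence :: "(real \<Rightarrow> real) \<Rightarrow> (real \<Rightarrow> real) \<Rightarrow> real" where
  "bhattacharyya_divergence p q = - ln (LINT x|lborel. sqrt (p x * q x))"

end

theory Submission
  imports Defs
begin

text \<open>
  The Bhattacharyya coefficient of two Cauchy densities depends only on the hyperbolic distance
  \<open>2 s\<close> of the parameters, and Gauss's substitution shows that it equals \<open>1 / AGM(e\<^sup>s, e\<^sup>-\<^sup>s)\<close>.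
  Hence the divergence \<open>F(s)\<close> satisfies \<open>F(s) = r + F(r)\<close> with \<open>r = ln (cosh s) / 2\<close>, and it is the
  limit of the iterates \<open>G\<^sub>0 = 0\<close>, \<open>G\<^sub>n\<^sub>+\<^sub>1(s) = r + G\<^sub>n(r)\<close>. The bounds \<open>0 \<le> G'(s) \<le> s / 2\<close> and
  \<open>s G'(s) \<le> 2 G(s)\<close> are inherited from one iterate to the next, so \<open>F\<close> is increasing and
  \<open>F(s) / s\<^sup>2\<close> is decreasing. Therefore \<open>\<surd>F\<close> is increasing and subadditive, and the triangle
  inequality follows from that of the hyperbolic distance.
\<close>

subsection \<open>Hyperbolic functions\<close>

text \<open>Most inequalities of this section are read as nonnegativity of a difference that
  vanishes at 0, which reduces each of them to a bound on a derivative.\<close>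

lemma nonneg_of_deriv_nonneg:
  fixes f :: "real \<Rightarrow> real"
  assumes "0 \<le> s" "0 \<le> f 0"
    and "\<And>x. 0 \<le> x \<Longrightarrow> (f has_real_derivative f' x) (at x)"
    and "\<And>x. 0 \<le> x \<Longrightarrow> 0 \<le> f' x"
  shows "0 \<le> f s"
  using DERIV_nonneg_imp_nondecreasing[of 0 s f] assms by (meson order.trans)

lemma le_sinh: "s \<le> sinh s" if "0 \<le> s" for s :: real
proof -
  have "0 \<le> sinh s - s"
    by (rule nonneg_of_deriv_nonneg[where f = "\<lambda>x. sinh x - x" and f' = "\<lambda>x. cosh x - 1"])
      (use that in \<open>auto intro!: derivative_eq_intros simp: cosh_real_ge_1\<close>)
  then show ?thesis by simp
qed

lemma sinh_le_mult_cosh: "sinh s \<le> s * cosh s" if "0 \<le> s" for s :: real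
proof -
  have "0 \<le> s * cosh s - sinh s"
    by (rule nonneg_of_deriv_nonneg[where f = "\<lambda>x. x * cosh x - sinh x" and f' = "\<lambda>x. x * sinh x"])
      (use that in \<open>auto intro!: derivative_eq_intros simp: cosh_real_ge_1\<close>)
  then show ?thesis by simp
qed

lemma tanh_le_self: "tanh s \<le> s" if "0 \<le> s" for s :: real
  using sinh_le_mult_cosh[OF that] by (simp add: tanh_def divide_simps mult.commute)

lemma ln_cosh_nonneg: "0 \<le> ln (cosh s)" for s :: real
  by (simp add: cosh_real_ge_1)

lemma has_derivative_ln_cosh [derivative_intros]:
  "((\<lambda>x. ln (cosh x)) has_real_derivative tanh s) (at s)" for s :: real
  by (auto intro!: derivative_eq_intros simp: tanh_def field_simps)

text \<open>Convexity of \<open>ln (cosh x)\<close>: its tangent at \<open>s\<close> lies below it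
  at 0. The derivative of the difference is \<open>x\<close> times the second derivative
  \<open>1 - tanh x ^ 2\<close>.\<close>

lemma ln_cosh_le: "ln (cosh s) \<le> s * tanh s" if "0 \<le> s" for s :: real
proof -
  have "0 \<le> s * tanh s - ln (cosh s)"
  proof (rule nonneg_of_deriv_nonneg[where f = "\<lambda>x. x * tanh x - ln (cosh x)" and f' = "\<lambda>x. x * (1 - tanh x ^ 2)"])
    fix x :: real assume "0 \<le> x"
    moreover have "tanh x ^ 2 \<le> 1"
      using tanh_real_bounds[of x] by (auto simp: abs_square_le_1 abs_le_iff)
    ultimately show "0 \<le> x * (1 - tanh x ^ 2)" by simp
  qed (use that in \<open>auto intro!: derivative_eq_intros simp: algebra_simps\<close>)
  then show ?thesis by simp
qed

lemma ln_cosh_ge: "s - 1 \<le> ln (cosh s)" for s :: real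
proof -
  have "exp s / 2 \<le> cosh s" by (simp add: cosh_def)
  then have "ln (exp s / 2) \<le> ln (cosh s)"
    by (subst ln_le_cancel_iff) auto
  moreover have "ln (exp s / 2) = s - ln 2" by (simp add: ln_div)
  moreover have "ln 2 \<le> (1::real)" using ln_le_minus_one[of 2] by simp
  ultimately show ?thesis by simp
qed

text \<open>With \<open>r = ln (cosh s) / 2\<close> this reads
  \<open>tanh s * (1 + r / 2) \<le> s\<close>, which passes the bound \<open>s / 2\<close> on the
  derivative from one iterate to the next. The derivative of the difference is arranged so that two
  terms are nonnegative by the earlier bounds, while \<open>3 * x * sinh x / 4\<close> absorbs the
  negative one.\<close>

lemma tanh_ln_cosh_le: "tanh s * (1 + ln (cosh s) / 4) \<le> s" if "0 \<le> s" for s :: real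
proof -
  have "0 \<le> s * cosh s - sinh s * (1 + ln (cosh s) / 4)"
  proof (rule nonneg_of_deriv_nonneg[where f = "\<lambda>x. x * cosh x - sinh x * (1 + ln (cosh x) / 4)" and f' = "\<lambda>x. (3 * x * sinh x + cosh x * (x * tanh x - ln (cosh x)) + sinh x * (x - tanh x)) / 4 - x * sinh x / 4"])
    fix x :: real assume x: "0 \<le> x"
    have eq: "cosh x * tanh x = sinh x" by (simp add: tanh_def)
    show "((\<lambda>x. x * cosh x - sinh x * (1 + ln (cosh x) / 4)) has_real_derivative
       (3 * x * sinh x + cosh x * (x * tanh x - ln (cosh x)) + sinh x * (x - tanh x)) / 4 - x * sinh x / 4) (at x)"
      using eq by (auto intro!: derivative_eq_intros simp: field_simps)
    have "0 \<le> cosh x * (x * tanh x - ln (cosh x))" "0 \<le> sinh x * (x - tanh x)" "0 \<le> x * sinh x"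
      using ln_cosh_le[OF x] tanh_le_self[OF x] x by auto
    then show "0 \<le> (3 * x * sinh x + cosh x * (x * tanh x - ln (cosh x)) + sinh x * (x - tanh x)) / 4 - x * sinh x / 4"
      by simp
  qed (use that in auto)
  then show ?thesis by (simp add: tanh_def field_simps)
qed

text \<open>The constant 7 is \<open>2 * 4 - 1\<close>, from differentiating the difference in the
  next inequality. The estimates \<open>x * tanh x \<le> x\<close> and
  \<open>ln (cosh x) \<ge> x - 1\<close> leave a margin of 3 in the second factor of the
  derivative.\<close>

lemma two_mult_cosh_le: "2 * s * cosh s \<le> (2 * ln (cosh s) + 7) * sinh s" if "0 \<le> s" for s :: real
proof -
  have "0 \<le> (2 * ln (cosh s) + 7) * sinh s - 2 * s * cosh s"
  proof (rule nonneg_of_deriv_nonneg[where f = "\<lambda>x. (2 * ln (cosh x) + 7) * sinh x - 2 * x * cosh x" and f' = "\<lambda>x. cosh x * (5 + 2 * ln (cosh x) + 2 * tanh x ^ 2 - 2 * x * tanh x)"])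
    fix x :: real assume x: "0 \<le> x"
    have eq: "cosh x * tanh x = sinh x" by (simp add: tanh_def)
    show "((\<lambda>x. (2 * ln (cosh x) + 7) * sinh x - 2 * x * cosh x) has_real_derivative
       cosh x * (5 + 2 * ln (cosh x) + 2 * tanh x ^ 2 - 2 * x * tanh x)) (at x)"
      by (auto intro!: derivative_eq_intros simp: eq[symmetric] algebra_simps power2_eq_square)
    have "x * tanh x \<le> x * 1" using x tanh_real_lt_1[of x] by (intro mult_left_mono) auto
    then have "0 \<le> 5 + 2 * ln (cosh x) + 2 * tanh x ^ 2 - 2 * x * tanh x"
      using ln_cosh_ge[of x] zero_le_power2[of "tanh x"] by linarith
    then show "0 \<le> cosh x * (5 + 2 * ln (cosh x) + 2 * tanh x ^ 2 - 2 * x * tanh x)"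
      by (simp add: cosh_real_nonneg)
  qed (use that in auto)
  then show ?thesis by simp
qed

text \<open>Up to the factor \<open>cosh s ^ 2\<close>, this is nonnegativity of the derivative that
  occurs in the following lemma.\<close>

lemma mult_sinh_sq_le: "s * sinh s ^ 2 \<le> (4 + ln (cosh s)) * (sinh s * cosh s - s)" if "0 \<le> s" for s :: real
proof -
  have "0 \<le> (4 + ln (cosh s)) * (sinh s * cosh s - s) - s * sinh s ^ 2"
  proof (rule nonneg_of_deriv_nonneg[where f = "\<lambda>x. (4 + ln (cosh x)) * (sinh x * cosh x - x) - x * sinh x ^ 2" and f' = "\<lambda>x. sinh x * ((2 * ln (cosh x) + 7) * sinh x - 2 * x * cosh x) + tanh x * (sinh x * cosh x - x)"])
    fix x :: real assume x: "0 \<le> x"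
    have eq: "cosh x * tanh x = sinh x" by (simp add: tanh_def)
    have eq2: "cosh x * (cosh x * z) = z + sinh x * (sinh x * z)" "cosh x * cosh x = 1 + sinh x * sinh x" for z
      using cosh_square_eq[of x] by (simp_all add: power2_eq_square mult.assoc[symmetric] distrib_right)
    show "((\<lambda>x. (4 + ln (cosh x)) * (sinh x * cosh x - x) - x * sinh x ^ 2) has_real_derivative
       sinh x * ((2 * ln (cosh x) + 7) * sinh x - 2 * x * cosh x) + tanh x * (sinh x * cosh x - x)) (at x)"
      by (auto intro!: derivative_eq_intros simp: algebra_simps power2_eq_square eq2)
    have "x * 1 \<le> sinh x * cosh x" using x le_sinh[OF x] cosh_real_ge_1[of x] by (intro mult_mono) auto
    then show "0 \<le> sinh x * ((2 * ln (cosh x) + 7) * sinh x - 2 * x * cosh x) + tanh x * (sinh x * cosh x - x)"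
      using two_mult_cosh_le[OF x] x by (auto intro!: add_nonneg_nonneg mult_nonneg_nonneg)
  qed (use that in auto)
  then show ?thesis by simp
qed

text \<open>With \<open>ln (cosh s) = 2 * r\<close> this is, up to a factor 4, the inequality
  \<open>s * tanh s * (1 + g) \<le> 2 * r * (2 + g)\<close> at \<open>g = r / 2\<close>, the extreme
  case in the induction for the iterates.\<close>

lemma mult_tanh_le: "s * tanh s * (4 + ln (cosh s)) \<le> ln (cosh s) * (8 + ln (cosh s))" if "0 \<le> s" for s :: real
proof -
  have "0 \<le> ln (cosh s) * (8 + ln (cosh s)) - s * tanh s * (4 + ln (cosh s))"
  proof (rule nonneg_of_deriv_nonneg[where f = "\<lambda>x. ln (cosh x) * (8 + ln (cosh x)) - x * tanh x * (4 + ln (cosh x))" and f' = "\<lambda>x. (4 + ln (cosh x)) * (tanh x - x * (1 - tanh x ^ 2)) - x * tanh x ^ 2"])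
    fix x :: real assume x: "0 \<le> x"
    show "((\<lambda>x. ln (cosh x) * (8 + ln (cosh x)) - x * tanh x * (4 + ln (cosh x))) has_real_derivative
       (4 + ln (cosh x)) * (tanh x - x * (1 - tanh x ^ 2)) - x * tanh x ^ 2) (at x)"
      by (auto intro!: derivative_eq_intros simp: algebra_simps power2_eq_square)
    have alg: "k * (S / C - x * (1 / C\<^sup>2)) - x * (S / C)\<^sup>2 = (k * (S * C - x) - x * S\<^sup>2) / C\<^sup>2"
      if "C \<noteq> 0" for C k S :: real
      using that by (simp add: field_simps power2_eq_square)
    have "1 - tanh x ^ 2 = (cosh x ^ 2 - sinh x ^ 2) / cosh x ^ 2"
      by (simp add: tanh_def power_divide diff_divide_distrib)
    then have "1 - tanh x ^ 2 = 1 / cosh x ^ 2"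
      by (simp add: hyperbolic_pythagoras)
    then have "(4 + ln (cosh x)) * (tanh x - x * (1 - tanh x ^ 2)) - x * tanh x ^ 2
       = ((4 + ln (cosh x)) * (sinh x * cosh x - x) - x * sinh x ^ 2) / cosh x ^ 2"
      using alg[of "cosh x" "4 + ln (cosh x)" "sinh x"] by (simp add: tanh_def)
    then show "0 \<le> (4 + ln (cosh x)) * (tanh x - x * (1 - tanh x ^ 2)) - x * tanh x ^ 2"
      using mult_sinh_sq_le[OF x] by simp
  qed (use that in auto)
  then show ?thesis by simp
qed

subsection \<open>The iterates\<close>

text \<open>A normalised step of the arithmetic-geometric mean: \<open>exp s\<close> and
  \<open>exp (-s)\<close> have the means \<open>cosh s\<close> and 1, which are \<open>exp r\<close>
  times \<open>exp r\<close> and \<open>exp (-r)\<close> for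
  \<open>r = half_ln_cosh s\<close>.\<close>

definition half_ln_cosh :: "real \<Rightarrow> real" where
  "half_ln_cosh s = ln (cosh s) / 2"

primrec agm_sum :: "nat \<Rightarrow> real \<Rightarrow> real" where
  "agm_sum 0 s = 0"
| "agm_sum (Suc n) s = half_ln_cosh s + agm_sum n (half_ln_cosh s)"

primrec agm_sum_deriv :: "nat \<Rightarrow> real \<Rightarrow> real" where
  "agm_sum_deriv 0 s = 0"
| "agm_sum_deriv (Suc n) s = tanh s / 2 * (1 + agm_sum_deriv n (half_ln_cosh s))"

lemma half_ln_cosh_nonneg: "0 \<le> half_ln_cosh s"
  by (simp add: half_ln_cosh_def ln_cosh_nonneg)

lemma has_derivative_half_ln_cosh:
  "(half_ln_cosh has_real_derivative tanh s / 2) (at s)"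
  unfolding half_ln_cosh_def by (auto intro!: derivative_eq_intros)

text \<open>Each step at least halves the argument, so the iterates converge geometrically.\<close>

lemma half_ln_cosh_le: "half_ln_cosh s \<le> s / 2" if "0 \<le> s"
proof -
  have "s * tanh s \<le> s * 1" using that tanh_real_lt_1[of s] by (intro mult_left_mono) auto
  then show ?thesis using ln_cosh_le[OF that] by (simp add: half_ln_cosh_def)
qed

lemma has_derivative_agm_sum:
  "(agm_sum n has_real_derivative agm_sum_deriv n s) (at s)"
proof (induction n arbitrary: s)
  case 0
  have "agm_sum 0 = (\<lambda>_. 0)" by auto
  then show ?case by simp
next
  case (Suc n)
  have "((\<lambda>s. half_ln_cosh s + agm_sum n (half_ln_cosh s)) has_real_derivative
      tanh s / 2 + agm_sum_deriv n (half_ln_cosh s) * (tanh s / 2)) (at s)"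
    by (intro DERIV_add has_derivative_half_ln_cosh DERIV_chain2[OF Suc])
  moreover have "agm_sum (Suc n) = (\<lambda>s. half_ln_cosh s + agm_sum n (half_ln_cosh s))" by auto
  ultimately show ?case by (simp only: agm_sum_deriv.simps) (simp add: algebra_simps add_divide_distrib)
qed

text \<open>The bounds are proved together because the third at \<open>s\<close> uses the second at
  \<open>r = half_ln_cosh s\<close>. Since \<open>r * g \<le> 2 * agm_sum n r\<close>, the third
  reduces to \<open>s * tanh s * (1 + g) \<le> 2 * r * (2 + g)\<close>.\<close>

lemma agm_sum_deriv_bounds:
  assumes "0 \<le> s"
  shows "0 \<le> agm_sum_deriv n s \<and> agm_sum_deriv n s \<le> s / 2 \<and> s * agm_sum_deriv n s \<le> 2 * agm_sum n s"
  using assms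
proof (induction n arbitrary: s)
  case 0
  then show ?case by simp
next
  case (Suc n)
  define r where "r = half_ln_cosh s"
  define g where "g = agm_sum_deriv n r"
  have r: "ln (cosh s) = 2 * r" "0 \<le> r" by (auto simp: r_def half_ln_cosh_def ln_cosh_nonneg)
  have IH: "0 \<le> g" "g \<le> r / 2" "r * g \<le> 2 * agm_sum n r"
    using Suc.IH[OF r(2)] by (auto simp: g_def)
  have T: "0 \<le> tanh s" using Suc.prems by simp
  have "tanh s * (1 + g) \<le> tanh s * (1 + r / 2)"
    using T IH by (intro mult_left_mono) auto
  also have "\<dots> \<le> s" using tanh_ln_cosh_le[OF Suc.prems] r by (simp add: field_simps)
  finally have 1: "tanh s * (1 + g) \<le> s" .
  have le: "2 * r \<le> s * tanh s" using ln_cosh_le[OF Suc.prems] r by simp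
  have "s * tanh s * (4 + 2 * r) \<le> 2 * r * (8 + 2 * r)" using mult_tanh_le[OF Suc.prems] r by simp
  \<comment> \<open>As \<open>2 * r \<le> s * tanh s\<close>, the reduced inequality is hardest for
    large \<open>g\<close>, so \<open>g\<close> may be replaced by its upper bound
    \<open>r / 2\<close>.\<close>
  moreover have "g * (s * tanh s - 2 * r) \<le> r / 2 * (s * tanh s - 2 * r)"
    using le IH by (intro mult_right_mono) auto
  ultimately have "s * tanh s * (1 + g) \<le> 2 * r * (2 + g)" by (simp add: algebra_simps)
  with 1 IH T show ?case by (simp add: r_def[symmetric] g_def[symmetric] algebra_simps)
qed

lemma agm_sum_mono: "agm_sum n s \<le> agm_sum n t" if "0 \<le> s" "s \<le> t"
proof (rule DERIV_nonneg_imp_nondecreasing[OF that(2)])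
  fix x assume "s \<le> x" "x \<le> t"
  then show "\<exists>y. (agm_sum n has_real_derivative y) (at x) \<and> 0 \<le> y"
    using has_derivative_agm_sum agm_sum_deriv_bounds[of x n] that by (meson order.trans)
qed

lemma agm_sum_div_square_antimono: "agm_sum n t / t\<^sup>2 \<le> agm_sum n s / s\<^sup>2" if "0 < s" "s \<le> t"
proof (rule DERIV_nonpos_imp_nonincreasing[of s t], goal_cases)
  case (2 x)
  then have x: "0 < x" using that by simp
  have "((\<lambda>x. agm_sum n x / x\<^sup>2) has_real_derivative
     (x * agm_sum_deriv n x - 2 * agm_sum n x) / x ^ 3) (at x)"
    using x by (auto intro!: derivative_eq_intros has_derivative_agm_sum simp: field_simps eval_nat_numeral)
  moreover have "(x * agm_sum_deriv n x - 2 * agm_sum n x) / x ^ 3 \<le> 0"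
    using x agm_sum_deriv_bounds[of x n] by (intro divide_nonpos_pos) auto
  ultimately show ?case by blast
qed (use that in auto)

subsection \<open>The Bhattacharyya coefficient of two Cauchy densities\<close>

text \<open>Under \<open>x = tan t\<close> both quadratic factors acquire a factor
  \<open>1 + (tan t)^2\<close>. The root of their product cancels this against the derivative of
  \<open>tan\<close>, and \<open>\<rho> < A\<close> keeps the remaining radicand positive.\<close>

lemma tan_substitution:
  fixes A \<rho> \<tau> :: real
  assumes "0 \<le> \<rho>" "\<rho> < A"
  defines "f \<equiv> \<lambda>x. 1 / sqrt ((1 + x\<^sup>2) * (A * (1 + x\<^sup>2) + \<rho> * (cos (2 * \<tau>) * (1 - x\<^sup>2) + 2 * sin (2 * \<tau>) * x)))"
  shows "integrable lborel f"
    and "(LINT x|lborel. f x) = integral {-pi/2..pi/2} (\<lambda>t. 1 / sqrt (A + \<rho> * cos (2 * (t - \<tau>))))"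
proof -
  define Q where "Q = (\<lambda>x. A * (1 + x\<^sup>2) + \<rho> * (cos (2 * \<tau>) * (1 - x\<^sup>2) + 2 * sin (2 * \<tau>) * x))"
  define k where "k = (\<lambda>t. A + \<rho> * cos (2 * (t - \<tau>)))"
  have k_pos: "0 < k t" for t
  proof -
    have "\<rho> * (-1) \<le> \<rho> * cos (2 * (t - \<tau>))" using assms(1) by (intro mult_left_mono) auto
    then show ?thesis using assms(2) by (simp add: k_def)
  qed
  have k_cont: "continuous_on S (\<lambda>t. 1 / sqrt (k t))" for S
    using k_pos by (auto intro!: continuous_intros simp: k_def less_imp_neq[THEN not_sym])
  have cos_pos: "0 < cos t" if "- (pi / 2) < t" "t < pi / 2" for t
    using cos_gt_zero_pi[of t] that by simp
  have Q_tan: "Q (tan t) = (1 + (tan t)\<^sup>2) * k t" if "0 < cos t" for t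
  proof -
    define T where "T = tan t"
    define c where "c = cos t"
    have sin: "sin t = T * c" using that by (simp add: T_def c_def tan_def)
    have sec: "(1 + T\<^sup>2) * c\<^sup>2 = 1"
      using that tan_sec[of t] by (simp add: T_def c_def field_simps)
    have k: "k t = A + \<rho> * (cos (2 * \<tau>) * (c\<^sup>2 - (T * c)\<^sup>2) + sin (2 * \<tau>) * (2 * (T * c) * c))"
      unfolding k_def right_diff_distrib cos_diff cos_double[of t] sin_double[of t] sin c_def[symmetric]
      by (simp add: algebra_simps)
    have "(1 + T\<^sup>2) * k t = A * (1 + T\<^sup>2)
        + \<rho> * (cos (2 * \<tau>) * (1 - T\<^sup>2) + 2 * sin (2 * \<tau>) * T) * ((1 + T\<^sup>2) * c\<^sup>2)"
      unfolding k by (simp add: algebra_simps power2_eq_square)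
    then show ?thesis unfolding sec by (simp add: Q_def T_def)
  qed
  have Q_pos: "0 < Q (tan t)" if "0 < cos t" for t
    unfolding Q_tan[OF that] using k_pos by (intro mult_pos_pos add_pos_nonneg) auto
  have f_tan: "f (tan t) * (1 + (tan t)\<^sup>2) = 1 / sqrt (k t)" if "0 < cos t" for t
  proof -
    have "f (tan t) = 1 / sqrt ((1 + (tan t)\<^sup>2)\<^sup>2 * k t)"
      unfolding f_def Q_def[symmetric] using Q_tan[OF that] by (simp add: Q_def power2_eq_square mult.assoc)
    also have "\<dots> = 1 / ((1 + (tan t)\<^sup>2) * sqrt (k t))"
      by (simp add: real_sqrt_mult add_nonneg_nonneg)
    finally show ?thesis by (simp add: add_nonneg_eq_0_iff)
  qed
  \<comment> \<open>Integrability is immediate on the trigonometric side, where the integrand is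
    continuous on a compact interval. The substitution rule for nonnegative integrands carries it
    back to \<open>f\<close>.\<close>
  have int: "set_integrable lborel (einterval (-pi/2) (pi/2)) (\<lambda>t. f (tan t) * (1 + (tan t)\<^sup>2))"
  proof -
    have "set_integrable lborel {-pi/2..pi/2} (\<lambda>t. 1 / sqrt (k t))"
      by (rule borel_integrable_atLeastAtMost'[OF k_cont])
    then have "set_integrable lborel {-pi/2<..<pi/2} (\<lambda>t. 1 / sqrt (k t))"
      by (rule set_integrable_subset) auto
    also have "?this \<longleftrightarrow> ?thesis"
      by (simp, intro set_integrable_cong) (auto simp: f_tan cos_pos)
    finally show ?thesis .
  qed
  have cos_pos': "0 < cos t" if "ereal (-pi/2) < ereal t" "ereal t < ereal (pi/2)" for t
    using that cos_pos by simp
  have deriv: "(tan has_real_derivative 1 + (tan t)\<^sup>2) (at t)" if "0 < cos t" for t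
    using that by (subst tan_sec) (auto intro!: DERIV_tan simp: power_inverse)
  have cont: "isCont f (tan t)" if "0 < cos t" for t
    using Q_pos[OF that] that unfolding f_def Q_def
    by (intro continuous_intros) (auto simp: add_nonneg_eq_0_iff)
  have cont': "isCont (\<lambda>t. 1 + (tan t)\<^sup>2) t" if "0 < cos t" for t :: real
    using that by (intro continuous_intros) auto
  have nonneg: "0 \<le> f (tan t)" if "0 < cos t" for t
    using Q_pos[OF that] by (simp add: f_def Q_def)
  have lim: "((ereal \<circ> tan \<circ> real_of_ereal) \<longlongrightarrow> - \<infinity>) (at_right (ereal (-pi/2)))"
    "((ereal \<circ> tan \<circ> real_of_ereal) \<longlongrightarrow> \<infinity>) (at_left (ereal (pi/2)))"
    using filterlim_tan_at_right filterlim_tan_at_left by (simp_all add: ereal_tendsto_simps)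
  have less: "ereal (-pi/2) < ereal (pi/2)" by simp
  note sub = interval_integral_substitution_nonneg[OF less deriv[OF cos_pos'] cont[OF cos_pos']
      cont'[OF cos_pos'] nonneg[OF cos_pos'] _ lim int, simplified]
  show "integrable lborel f" using sub(1) by (simp add: set_integrable_def)
  have "(LINT x|lborel. f x) = (LBINT x=-\<infinity>..\<infinity>. f x)"
    by (simp add: interval_lebesgue_integral_def set_lebesgue_integral_def)
  also have "\<dots> = (LBINT t=-pi/2..pi/2. 1 / sqrt (k t))"
    unfolding sub(2) minus_divide_left by (intro interval_integral_cong) (auto simp: f_tan cos_pos min_def max_def)
  also have "\<dots> = integral {-pi/2..pi/2} (\<lambda>t. 1 / sqrt (k t))"
    by (subst interval_integral_eq_integral)
      (auto intro!: borel_integrable_atLeastAtMost'[OF k_cont, of "-pi/2" "pi/2", simplified])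
  finally show "(LINT x|lborel. f x) = integral {-pi/2..pi/2} (\<lambda>t. 1 / sqrt (A + \<rho> * cos (2 * (t - \<tau>))))"
    by (simp add: k_def)
qed

text \<open>The piece \<open>{a - \<tau>..a}\<close> that the shift pushes out on the left is
  carried by one period onto the piece missing on the right.\<close>

lemma integral_periodic_shift:
  fixes f :: "real \<Rightarrow> real"
  assumes cont: "continuous_on UNIV f" and per: "\<And>x. f (x + p) = f x"
    and \<tau>: "0 \<le> \<tau>" "\<tau> \<le> p"
  shows "integral {a..a + p} (\<lambda>x. f (x - \<tau>)) = integral {a..a + p} f"
proof -
  have int: "f integrable_on {u..v}" for u v
    by (intro integrable_continuous_interval continuous_on_subset[OF cont]) auto
  have "integral {a..a + p} (\<lambda>x. f (x - \<tau>)) = integral {a - \<tau>..a + p - \<tau>} f"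
    using integral_shift_Icc_real[of a "a + p" f "-\<tau>"] by (simp add: o_def)
  also have "\<dots> = integral {a - \<tau>..a} f + integral {a..a + p - \<tau>} f"
    using \<tau> by (intro Henstock_Kurzweil_Integration.integral_combine[symmetric] int) auto
  also have "integral {a - \<tau>..a} f = integral {a - \<tau>..a} (\<lambda>x. f (p + x))"
    by (simp add: per add.commute)
  also have "\<dots> = integral {a + p - \<tau>..a + p} f"
    using integral_shift_Icc_real[of "a - \<tau>" a f p] by (simp add: o_def algebra_simps)
  also have "\<dots> + integral {a..a + p - \<tau>} f = integral {a..a + p} f"
    using \<tau> by (subst add.commute, intro Henstock_Kurzweil_Integration.integral_combine int) auto
  finally show ?thesis .
qed

text \<open>For \<open>A \<ge> 1\<close> this is Laplace's integral for the Legendre function of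
  degree -1/2, a complete elliptic integral.\<close>

definition bhat_trig :: "real \<Rightarrow> real" where
  "bhat_trig A = integral {-pi/2..pi/2} (\<lambda>t. 1 / sqrt (A + sqrt (A\<^sup>2 - 1) * cos (2 * t))) / pi"

lemma sqrt_square_minus_1_less: "sqrt (A\<^sup>2 - 1) < A" if "1 \<le> A" for A :: real
  using that by (intro real_less_lsqrt) auto

text \<open>The polar angle of \<open>(B, C)\<close> only shifts a periodic integrand, so the
  integral depends on \<open>A\<close> alone. The hypothesis says that the quadratic has determinant
  \<open>(A - B) * (A + B) - C^2 = 1\<close>.\<close>

lemma integral_quadratic_eq_bhat_trig:
  fixes A B C :: real
  assumes A: "1 \<le> A" "A\<^sup>2 - 1 = B\<^sup>2 + C\<^sup>2"
  defines "f \<equiv> \<lambda>x. 1 / sqrt ((1 + x\<^sup>2) * ((A - B) * x\<^sup>2 + 2 * C * x + (A + B)))"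
  shows "integrable lborel f" "(LINT x|lborel. f x) = pi * bhat_trig A"
proof -
  define \<rho> where "\<rho> = sqrt (A\<^sup>2 - 1)"
  have \<rho>: "0 \<le> \<rho>" "\<rho> < A" using A sqrt_square_minus_1_less[of A] by (auto simp: \<rho>_def)
  have \<rho>2: "\<rho>\<^sup>2 = B\<^sup>2 + C\<^sup>2" using A by (simp add: \<rho>_def)
  \<comment> \<open>Doubling the angle lets \<open>\<tau>\<close> stay within one period
    \<open>pi\<close> of the integrand.\<close>
  obtain \<tau> where \<tau>: "0 \<le> \<tau>" "\<tau> \<le> pi" "B = \<rho> * cos (2 * \<tau>)" "C = \<rho> * sin (2 * \<tau>)"
  proof (cases "\<rho> = 0")
    case True
    then have "B = 0" "C = 0" using \<rho>2 by (auto simp: sum_power2_eq_zero_iff)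
    then show ?thesis using that[of 0] True by simp
  next
    case False
    then have "(B / \<rho>)\<^sup>2 + (C / \<rho>)\<^sup>2 = 1"
      by (simp add: power_divide add_divide_distrib[symmetric] \<rho>2[symmetric])
    then obtain t where "0 \<le> t" "t < 2 * pi" "B / \<rho> = cos t" "C / \<rho> = sin t"
      using sincos_total_2pi by metis
    then show ?thesis using that[of "t / 2"] False by (simp add: field_simps)
  qed
  have f: "f = (\<lambda>x. 1 / sqrt ((1 + x\<^sup>2) * (A * (1 + x\<^sup>2) + \<rho> * (cos (2 * \<tau>) * (1 - x\<^sup>2) + 2 * sin (2 * \<tau>) * x))))"
    unfolding f_def \<tau>(3,4) by (simp add: algebra_simps)
  show "integrable lborel f" unfolding f by (rule tan_substitution[OF \<rho>])
  have pos: "0 < A + \<rho> * cos x" for x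
  proof -
    have "\<rho> * (-1) \<le> \<rho> * cos x" using \<rho>(1) by (intro mult_left_mono) auto
    then show ?thesis using \<rho>(2) by simp
  qed
  have "(LINT x|lborel. f x) = integral {-pi/2..-pi/2 + pi} (\<lambda>t. 1 / sqrt (A + \<rho> * cos (2 * (t - \<tau>))))"
    unfolding f tan_substitution(2)[OF \<rho>] by simp
  also have "\<dots> = integral {-pi/2..-pi/2 + pi} (\<lambda>t. 1 / sqrt (A + \<rho> * cos (2 * t)))"
    using pos by (intro integral_periodic_shift[where f = "\<lambda>t. 1 / sqrt (A + \<rho> * cos (2 * t))"] \<tau>)
      (auto intro!: continuous_intros simp: less_imp_neq[THEN not_sym] distrib_left)
  finally show "(LINT x|lborel. f x) = pi * bhat_trig A" by (simp add: bhat_trig_def \<rho>_def)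
qed

text \<open>The hyperbolic cosine of the hyperbolic distance in the upper half plane.\<close>

definition cosh_dist :: "complex \<Rightarrow> complex \<Rightarrow> real" where
  "cosh_dist \<theta> \<phi> = 1 + (cmod (\<theta> - \<phi>))\<^sup>2 / (2 * Im \<theta> * Im \<phi>)"

lemma cosh_dist_ge_1: "1 \<le> cosh_dist \<theta> \<phi>" if "0 < Im \<theta>" "0 < Im \<phi>"
  using that by (simp add: cosh_dist_def)

text \<open>In the coordinate \<open>x\<close> of the point \<open>Re \<theta> + y * x\<close>, the
  parameter \<open>\<theta>\<close> becomes \<open>\<i>\<close>. The squared distance to
  \<open>\<phi>\<close>, divided by \<open>y * v\<close>, is then a quadratic of determinant 1 in
  \<open>x\<close>, and its coefficients dictate \<open>A\<close>, \<open>B\<close> and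
  \<open>C\<close>.\<close>

lemma bhattacharyya_coefficient_cauchy:
  assumes "0 < Im \<theta>" "0 < Im \<phi>"
  shows "integrable lborel (\<lambda>x. sqrt (cauchy_density \<theta> x * cauchy_density \<phi> x))"
    and "(LINT x|lborel. sqrt (cauchy_density \<theta> x * cauchy_density \<phi> x)) = bhat_trig (cosh_dist \<theta> \<phi>)"
proof -
  define y where "y = Im \<theta>"
  define v where "v = Im \<phi>"
  define w where "w = Re \<theta> - Re \<phi>"
  define A where "A = (y\<^sup>2 + v\<^sup>2 + w\<^sup>2) / (2 * y * v)"
  define B where "B = (w\<^sup>2 + v\<^sup>2 - y\<^sup>2) / (2 * y * v)"
  define C where "C = w / v"
  define F where "F = (\<lambda>x. sqrt (cauchy_density \<theta> x * cauchy_density \<phi> x))"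
  have pos: "0 < y" "0 < v" using assms by (auto simp: y_def v_def)
  have A: "A = cosh_dist \<theta> \<phi>"
    unfolding A_def cosh_dist_def cmod_power2
    using pos by (simp add: y_def[symmetric] v_def[symmetric] w_def[symmetric] field_simps power2_eq_square)
  have A1: "1 \<le> A" using cosh_dist_ge_1[OF assms] A by simp
  have A2: "A\<^sup>2 - 1 = B\<^sup>2 + C\<^sup>2"
    using pos by (simp add: A_def B_def C_def field_simps power2_eq_square)
  note trig = integral_quadratic_eq_bhat_trig[OF A1 A2]
  have F: "F (Re \<theta> + y * x) = (1 / sqrt ((1 + x\<^sup>2) * ((A - B) * x\<^sup>2 + 2 * C * x + (A + B)))) / (pi * y)" for x
  proof -
    have 1: "(cmod (complex_of_real (Re \<theta> + y * x) - \<theta>))\<^sup>2 = y\<^sup>2 * (1 + x\<^sup>2)"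
      by (simp add: cmod_power2 y_def field_simps power_mult_distrib)
    have 2: "(cmod (complex_of_real (Re \<theta> + y * x) - \<phi>))\<^sup>2 = y * v * ((A - B) * x\<^sup>2 + 2 * C * x + (A + B))"
      unfolding cmod_power2
      using pos by (simp add: A_def B_def C_def w_def v_def[symmetric] field_simps power2_eq_square)
    \<comment> \<open>For \<open>a = 0\<close> or \<open>q = 0\<close> both sides are 0, by the
      convention on division by zero.\<close>
    have cancel: "y / (pi * (y\<^sup>2 * a)) * (v / (pi * (y * v * q))) = 1 / ((pi * y)\<^sup>2 * (a * q))" for a q :: real
      using pos by (cases "a = 0"; cases "q = 0") (simp_all add: field_simps power2_eq_square)
    have "F (Re \<theta> + y * x) = sqrt (1 / ((pi * y)\<^sup>2 * ((1 + x\<^sup>2) * ((A - B) * x\<^sup>2 + 2 * C * x + (A + B)))))"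
      unfolding F_def cauchy_density_def 1 2 y_def[symmetric] v_def[symmetric] cancel ..
    then show ?thesis using pos by (simp add: real_sqrt_divide real_sqrt_mult)
  qed
  have "integrable lborel (\<lambda>x. F (Re \<theta> + y * x))"
    unfolding F using trig(1) by (rule integrable_divide_zero)
  then show "integrable lborel F"
    using lborel_integrable_real_affine_iff[of y F "Re \<theta>"] pos by simp
  have "(LINT x|lborel. F x) = y * (LINT x|lborel. F (Re \<theta> + y * x))"
    using lborel_integral_real_affine[of y F "Re \<theta>"] pos by simp
  also have "(LINT x|lborel. F (Re \<theta> + y * x)) = pi * bhat_trig A / (pi * y)"
    unfolding F trig(2)[symmetric] by (rule integral_divide_zero)
  also have "y * \<dots> = bhat_trig A" using pos by simp
  finally show "(LINT x|lborel. F x) = bhat_trig (cosh_dist \<theta> \<phi>)" by (simp add: A)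
qed

subsection \<open>Gauss's transformation\<close>

text \<open>The coefficient of the parameters \<open>\<i> e\<^sup>s\<close> and \<open>\<i> e\<^sup>-\<^sup>s\<close>.\<close>

definition bhat_geodesic :: "real \<Rightarrow> real" where
  "bhat_geodesic s = bhat_trig (cosh (2 * s))"

text \<open>The two parameters are at hyperbolic distance \<open>2 * s\<close>, which yields an
  algebraic integrand for the coefficient, the form to which Gauss's substitution applies.\<close>

lemma geodesic_integral:
  defines "K \<equiv> \<lambda>s x. 1 / sqrt ((x\<^sup>2 + exp (2 * s)) * (x\<^sup>2 + exp (-2 * s)))"
  shows "integrable lborel (K s)" "(LINT x|lborel. K s x) = pi * bhat_geodesic s"
proof -
  define \<theta> where "\<theta> = Complex 0 (exp s)"
  define \<phi> where "\<phi> = Complex 0 (exp (-s))"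
  have im: "0 < Im \<theta>" "0 < Im \<phi>" by (auto simp: \<theta>_def \<phi>_def)
  have exp2: "(exp u)\<^sup>2 = exp (2 * u)" for u :: real by (simp add: exp_double)
  have "sqrt (cauchy_density \<theta> x * cauchy_density \<phi> x) = K s x / pi" for x
  proof -
    have "(cmod (complex_of_real x - \<theta>))\<^sup>2 = x\<^sup>2 + exp (2 * s)"
      "(cmod (complex_of_real x - \<phi>))\<^sup>2 = x\<^sup>2 + exp (-2 * s)"
      unfolding cmod_power2 by (simp_all add: \<theta>_def \<phi>_def exp2)
    then have "cauchy_density \<theta> x * cauchy_density \<phi> x
        = (exp s * exp (-s)) / (pi\<^sup>2 * ((x\<^sup>2 + exp (2 * s)) * (x\<^sup>2 + exp (-2 * s))))"
      by (simp add: cauchy_density_def \<theta>_def \<phi>_def power2_eq_square mult_ac)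
    also have "exp s * exp (-s) = 1" by (simp add: exp_minus)
    finally show ?thesis by (simp add: K_def real_sqrt_divide real_sqrt_mult)
  qed
  moreover have "cosh_dist \<theta> \<phi> = cosh (2 * s)"
  proof -
    have "(cmod (\<theta> - \<phi>))\<^sup>2 = (exp s - exp (-s))\<^sup>2" unfolding cmod_power2 by (simp add: \<theta>_def \<phi>_def)
    also have "\<dots> = 4 * sinh s ^ 2" by (simp add: sinh_def power_divide)
    finally have "cosh_dist \<theta> \<phi> = 1 + 4 * sinh s ^ 2 / (2 * (exp s * exp (-s)))"
      by (simp add: cosh_dist_def \<theta>_def \<phi>_def mult.assoc)
    also have "exp s * exp (-s) = 1" by (simp add: exp_minus)
    finally show ?thesis by (simp add: cosh_double cosh_square_eq)
  qed
  ultimately have *: "integrable lborel (\<lambda>x. K s x / pi)" "(LINT x|lborel. K s x / pi) = bhat_geodesic s"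
    using bhattacharyya_coefficient_cauchy[OF im] by (simp_all add: bhat_geodesic_def)
  show "integrable lborel (K s)" using integrable_mult_right[OF *(1), of pi] by simp
  show "(LINT x|lborel. K s x) = pi * bhat_geodesic s" using *(2) by (simp add: field_simps)
qed

lemma filterlim_self_minus_inverse:
  assumes "0 < c"
  shows "filterlim (\<lambda>x. c * (x - 1 / x)) at_bot (at_right (0::real))"
    and "filterlim (\<lambda>x. c * (x - 1 / x)) at_top (at_top :: real filter)"
proof -
  have "((\<lambda>x::real. - x) \<longlongrightarrow> 0) (at_right 0)"
    by (rule tendsto_eq_intros refl)+ simp
  then have "filterlim (\<lambda>x::real. - x + inverse x) at_top (at_right 0)"
    by (rule filterlim_tendsto_add_at_top[OF _ filterlim_inverse_at_top_right])
  then have "filterlim (\<lambda>x::real. c * (- x + inverse x)) at_top (at_right 0)"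
    by (rule filterlim_tendsto_pos_mult_at_top[OF tendsto_const assms])
  then show "filterlim (\<lambda>x. c * (x - 1 / x)) at_bot (at_right (0::real))"
    by (simp add: filterlim_uminus_at_bot field_simps)
  have "((\<lambda>x::real. - inverse x) \<longlongrightarrow> - 0) at_top"
    by (intro tendsto_minus tendsto_inverse_0_at_top filterlim_ident)
  then have "filterlim (\<lambda>x::real. - inverse x + x) at_top at_top"
    by (rule filterlim_tendsto_add_at_top[OF _ filterlim_ident])
  then have "filterlim (\<lambda>x::real. c * (- inverse x + x)) at_top at_top"
    by (rule filterlim_tendsto_pos_mult_at_top[OF tendsto_const assms])
  then show "filterlim (\<lambda>x. c * (x - 1 / x)) at_top (at_top :: real filter)"
    by (simp add: field_simps)
qed

lemma integral_even_half_line: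
  fixes f :: "real \<Rightarrow> real"
  assumes "integrable lborel f" "\<And>x. f (- x) = f x"
  shows "(LINT x|lborel. f x) = 2 * (LBINT x=0..\<infinity>. f x)"
proof -
  have "interval_lebesgue_integrable lborel (-\<infinity>) \<infinity> f"
    using assms(1) by (simp add: interval_lebesgue_integrable_def set_integrable_def)
  then have "(LBINT x=-\<infinity>..0. f x) + (LBINT x=0..\<infinity>. f x) = (LBINT x=-\<infinity>..\<infinity>. f x)"
    by (intro interval_integral_sum) (simp add: min_def max_def)
  moreover have "(LBINT x=-\<infinity>..0. f x) = (LBINT x=0..\<infinity>. f x)"
    by (subst interval_integral_reflect) (simp add: assms(2))
  moreover have "(LBINT x=-\<infinity>..\<infinity>. f x) = (LINT x|lborel. f x)"
    by (simp add: interval_lebesgue_integral_def set_lebesgue_integral_def)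
  ultimately show ?thesis by simp
qed

text \<open>The substitution is \<open>u = (x - 1 / x) / (2 e\<^sup>r)\<close>, which maps the positive half line onto the line.\<close>

lemma bhat_geodesic_landen:
  "bhat_geodesic (half_ln_cosh s) = exp (half_ln_cosh s) * bhat_geodesic s"
proof -
  define r where "r = half_ln_cosh s"
  define K where "K = (\<lambda>s x::real. 1 / sqrt ((x\<^sup>2 + exp (2 * s)) * (x\<^sup>2 + exp (-2 * s))))"
  define c where "c = 1 / (2 * exp r)"
  define g where "g = (\<lambda>x::real. c * (x - 1 / x))"
  define g' where "g' = (\<lambda>x::real. c * (1 + 1 / x\<^sup>2))"
  have c: "0 < c" by (simp add: c_def)
  have K: "integrable lborel (K s)" "(LINT x|lborel. K s x) = pi * bhat_geodesic s" for s
    using geodesic_integral[of s] by (simp_all add: K_def)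
  have cosh: "exp (2 * r) = cosh s" by (simp add: r_def half_ln_cosh_def)
  \<comment> \<open>Since \<open>exp (2 * r) = cosh s\<close>, one quadratic at \<open>g x\<close>
    becomes a perfect square, whose root cancels against \<open>g' x\<close> up to powers of
    \<open>x\<close>, and the other becomes a multiple of \<open>P / x^2\<close>, which restores the
    integrand for \<open>s\<close>.\<close>
  have Kg: "K r (g x) * g' x = 2 * exp r * K s x" if x: "0 < x" for x
  proof -
    define P where "P = (x\<^sup>2 + exp (2 * s)) * (x\<^sup>2 + exp (-2 * s))"
    have P: "0 < P" by (auto simp: P_def intro!: mult_pos_pos add_nonneg_pos)
    have c2: "c\<^sup>2 = 1 / (4 * exp (2 * r))" by (simp add: c_def power_divide power_mult_distrib exp_double)
    have "(g x)\<^sup>2 + exp (- 2 * r) = c\<^sup>2 * ((x - 1 / x)\<^sup>2 + 4)"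
      unfolding g_def power_mult_distrib by (simp add: c2 exp_minus field_simps)
    also have "(x - 1 / x)\<^sup>2 + 4 = (x + 1 / x)\<^sup>2"
      using x by (simp add: power2_eq_square field_simps)
    finally have 1: "(g x)\<^sup>2 + exp (- 2 * r) = c\<^sup>2 * (x + 1 / x)\<^sup>2" .
    have "(g x)\<^sup>2 + exp (2 * r) = c\<^sup>2 * ((x - 1 / x)\<^sup>2 + 4 * cosh s ^ 2)"
    proof -
      have "c\<^sup>2 * (4 * cosh s ^ 2) = exp (2 * r)" unfolding c2 cosh by (simp add: power2_eq_square)
      then show ?thesis by (simp add: g_def power_mult_distrib distrib_left)
    qed
    also have "(x - 1 / x)\<^sup>2 + 4 * cosh s ^ 2 = P / x\<^sup>2"
    proof -
      have "4 * cosh s ^ 2 = (exp s + exp (-s))\<^sup>2" by (simp add: cosh_def power_divide)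
      also have "\<dots> = (exp s)\<^sup>2 + (exp (-s))\<^sup>2 + 2 * (exp s * exp (-s))" by (simp add: power2_sum)
      also have "(exp s)\<^sup>2 = exp (2 * s)" by (simp add: exp_double)
      also have "(exp (-s))\<^sup>2 = exp (-2 * s)" using exp_double[of "-s"] by simp
      also have "exp s * exp (-s) = 1" by (simp add: exp_minus)
      finally have "4 * cosh s ^ 2 = exp (2 * s) + exp (-2 * s) + 2" by simp
      moreover have "exp (2 * s) * exp (-2 * s) = 1" by (simp add: mult_exp_exp)
      then have "P = x\<^sup>2 * x\<^sup>2 + x\<^sup>2 * (exp (2 * s) + exp (-2 * s)) + 1"
        by (simp add: P_def algebra_simps)
      ultimately show ?thesis using x by (simp add: field_simps power2_eq_square)
    qed
    finally have 2: "(g x)\<^sup>2 + exp (2 * r) = c\<^sup>2 * (P / x\<^sup>2)" .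
    have Kr: "K r (g x) = 1 / (c * (sqrt P / x) * (c * (x + 1 / x)))"
      unfolding K_def 1 2 using x c by (simp add: real_sqrt_mult real_sqrt_divide)
    have g': "g' x = c * (x + 1 / x) / x"
      using x by (simp add: g'_def field_simps power2_eq_square)
    have cancel: "1 / (c * (p / x) * w) * (w / x) = 1 / (c * p)" if "0 < w" for p w
      using that x by (simp add: field_simps)
    have "0 < c * (x + 1 / x)" using x c by (intro mult_pos_pos add_pos_pos) auto
    then have "K r (g x) * g' x = 1 / (c * sqrt P)" unfolding Kr g' by (rule cancel)
    then show ?thesis by (simp add: K_def P_def c_def)
  qed
  have int: "set_integrable lborel (einterval 0 \<infinity>) (\<lambda>x. K r (g x) * g' x)"
  proof -
    have "set_integrable lborel (einterval 0 \<infinity>) (K s)"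
      unfolding set_integrable_def by (rule integrable_mult_indicator[OF _ K(1)]) simp
    then have "set_integrable lborel (einterval 0 \<infinity>) (\<lambda>x. 2 * exp r * K s x)"
      by (rule set_integrable_mult_right)
    also have "?this \<longleftrightarrow> ?thesis"
      by (intro set_integrable_cong) (auto simp: Kg einterval_def zero_ereal_def)
    finally show ?thesis .
  qed
  have "(LBINT x=-\<infinity>..\<infinity>. K r x) = (LBINT x=0..\<infinity>. K r (g x) * g' x)"
  proof (rule interval_integral_substitution_nonneg(2)[where f = "K r" and g = g and g' = g' and a = 0 and b = \<infinity>])
    show "set_integrable lborel (einterval 0 \<infinity>) (\<lambda>x. K r (g x) * g' x)" by (rule int)
    show "(g has_real_derivative g' x) (at x)" if "0 < ereal x" for x
      using that by (auto simp: g_def g'_def power2_eq_square field_simps intro!: derivative_eq_intros)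
    show "isCont (K r) (g x)" for x
      unfolding K_def by (intro continuous_intros) (auto simp: add_nonneg_eq_0_iff)
    show "isCont g' x" if "0 < ereal x" for x
      using that unfolding g'_def by (intro continuous_intros) auto
    show "0 \<le> K r (g x)" for x
      unfolding K_def by (intro divide_nonneg_nonneg real_sqrt_ge_zero mult_nonneg_nonneg add_nonneg_nonneg) auto
    show "0 \<le> g' x" for x using c by (simp add: g'_def)
    show "((ereal \<circ> g \<circ> real_of_ereal) \<longlongrightarrow> -\<infinity>) (at_right 0)"
      using filterlim_self_minus_inverse(1)[OF c] by (simp add: g_def zero_ereal_def ereal_tendsto_simps)
    show "((ereal \<circ> g \<circ> real_of_ereal) \<longlongrightarrow> \<infinity>) (at_left \<infinity>)"
      using filterlim_self_minus_inverse(2)[OF c] by (simp add: g_def ereal_tendsto_simps)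
  qed simp
  also have "\<dots> = (LBINT x=0..\<infinity>. 2 * exp r * K s x)"
    by (intro interval_integral_cong) (auto simp: Kg einterval_def zero_ereal_def)
  also have "\<dots> = exp r * (2 * (LBINT x=0..\<infinity>. K s x))" by simp
  also have "2 * (LBINT x=0..\<infinity>. K s x) = pi * bhat_geodesic s"
    using integral_even_half_line[OF K(1)[of s]] K(2)[of s] by (simp add: K_def)
  also have "(LBINT x=-\<infinity>..\<infinity>. K r x) = pi * bhat_geodesic r"
    using K(2)[of r] by (simp add: interval_lebesgue_integral_def set_lebesgue_integral_def)
  finally show ?thesis by (simp add: r_def)
qed

text \<open>The radicand lies between \<open>cosh (2 * s) - sinh (2 * s)\<close> and
  \<open>cosh (2 * s) + sinh (2 * s)\<close>, which are \<open>exp (-2 * s)\<close> and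
  \<open>exp (2 * s)\<close>. These crude bounds give positivity and control the limit of the
  iterates.\<close>

lemma bhat_geodesic_bounds:
  assumes "0 \<le> s"
  shows "exp (-s) \<le> bhat_geodesic s" "bhat_geodesic s \<le> exp s"
proof -
  define k where "k = (\<lambda>t. cosh (2 * s) + sinh (2 * s) * cos (2 * t))"
  have sqrt: "sqrt ((cosh (2 * s))\<^sup>2 - 1) = sinh (2 * s)"
    using assms by (simp add: cosh_square_eq)
  have k: "exp (-2 * s) \<le> k t" "k t \<le> exp (2 * s)" for t
  proof -
    have "sinh (2 * s) * (-1) \<le> sinh (2 * s) * cos (2 * t)" "sinh (2 * s) * cos (2 * t) \<le> sinh (2 * s) * 1"
      using assms by (intro mult_left_mono; simp)+
    then show "exp (-2 * s) \<le> k t" "k t \<le> exp (2 * s)"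
      using cosh_plus_sinh[of "2 * s"] cosh_minus_sinh[of "2 * s"] by (simp_all add: k_def)
  qed
  have k_pos: "0 < k t" for t using k(1)[of t] exp_gt_zero less_le_trans by blast
  have sqrt_exp: "sqrt (exp (2 * u)) = exp u" for u :: real
    by (simp add: exp_double)
  have bounds: "exp (-s) \<le> 1 / sqrt (k t)" "1 / sqrt (k t) \<le> exp s" for t
  proof -
    have "exp (-s) = sqrt (exp (-2 * s))" using sqrt_exp[of "-s"] by simp
    also have "\<dots> \<le> sqrt (k t)" by (rule real_sqrt_le_mono[OF k(1)])
    finally have "exp (-s) \<le> sqrt (k t)" .
    then show "1 / sqrt (k t) \<le> exp s" using k_pos[of t] by (simp add: exp_minus divide_simps mult.commute)
    have "sqrt (k t) \<le> sqrt (exp (2 * s))" by (rule real_sqrt_le_mono[OF k(2)])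
    then have "sqrt (k t) \<le> exp s" unfolding sqrt_exp .
    then show "exp (-s) \<le> 1 / sqrt (k t)" using k_pos[of t] by (simp add: exp_minus divide_simps)
  qed
  have int: "(\<lambda>t. 1 / sqrt (k t)) integrable_on {-pi/2..pi/2}"
    using k_pos by (intro integrable_continuous_interval)
      (auto intro!: continuous_intros simp: k_def less_imp_neq[THEN not_sym])
  have "integral {-pi/2..pi/2} (\<lambda>t. exp (-s)) \<le> integral {-pi/2..pi/2} (\<lambda>t. 1 / sqrt (k t))"
    "integral {-pi/2..pi/2} (\<lambda>t. 1 / sqrt (k t)) \<le> integral {-pi/2..pi/2} (\<lambda>t. exp s)"
    by (intro integral_le int integrable_const_ivl bounds)+
  then show "exp (-s) \<le> bhat_geodesic s" "bhat_geodesic s \<le> exp s"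
    unfolding bhat_geodesic_def bhat_trig_def sqrt k_def by (simp_all add: divide_simps mult.commute)
qed

lemma bhat_geodesic_pos: "0 < bhat_geodesic s" if "0 \<le> s"
  using bhat_geodesic_bounds(1)[OF that] exp_gt_zero less_le_trans by blast

section \<open>The divergence as a function of half the hyperbolic distance\<close>

definition bhat_div :: "real \<Rightarrow> real" where
  "bhat_div s = - ln (bhat_geodesic s)"

lemma bhat_div_landen: "bhat_div s = half_ln_cosh s + bhat_div (half_ln_cosh s)" if "0 \<le> s"
  using bhat_geodesic_landen[of s] bhat_geodesic_pos[OF that] by (simp add: bhat_div_def ln_mult)

lemma abs_bhat_div_le: "\<bar>bhat_div s\<bar> \<le> s" if "0 \<le> s"
proof -
  note b = bhat_geodesic_bounds[OF that] bhat_geodesic_pos[OF that]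
  have "ln (exp (-s)) \<le> ln (bhat_geodesic s)" "ln (bhat_geodesic s) \<le> ln (exp s)"
    using b by (intro ln_mono; simp)+
  then show ?thesis by (simp add: bhat_div_def abs_le_iff)
qed

text \<open>In the recursion the term \<open>r = half_ln_cosh s\<close> compensates exactly for the
  crude bound \<open>-r\<close> on the divergence at \<open>r\<close>.\<close>

lemma bhat_div_nonneg: "0 \<le> bhat_div s" if "0 \<le> s"
  using bhat_div_landen[OF that] abs_bhat_div_le[OF half_ln_cosh_nonneg, of s] by linarith

lemma bhat_div_pos: "0 < bhat_div s" if "0 < s"
proof -
  have "1 < cosh s" using cosh_real_strict_mono[of 0 s] that by simp
  then have "0 < half_ln_cosh s" by (simp add: half_ln_cosh_def)
  then show ?thesis
    using bhat_div_landen[of s] bhat_div_nonneg[OF half_ln_cosh_nonneg, of s] that by simp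
qed

lemma bhat_div_0: "bhat_div 0 = 0"
  using abs_bhat_div_le[of 0] by simp

text \<open>The divergence and the iterates obey the same recursion, so the error at
  \<open>s\<close> after \<open>n + 1\<close> steps is the error at
  \<open>half_ln_cosh s \<le> s / 2\<close> after \<open>n\<close> steps.\<close>

lemma agm_sum_tendsto: "(\<lambda>n. agm_sum n s) \<longlonglongrightarrow> bhat_div s" if "0 \<le> s"
proof -
  have bound: "\<bar>bhat_div s - agm_sum n s\<bar> \<le> s / 2 ^ n" if "0 \<le> s" for s n
    using that
  proof (induction n arbitrary: s)
    case 0
    then show ?case using abs_bhat_div_le[of s] by simp
  next
    case (Suc n)
    have "\<bar>bhat_div s - agm_sum (Suc n) s\<bar> \<le> half_ln_cosh s / 2 ^ n"
      using Suc.IH[OF half_ln_cosh_nonneg, of s] bhat_div_landen[OF Suc.prems] by simp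
    also have "\<dots> \<le> (s / 2) / 2 ^ n"
      using half_ln_cosh_le[OF Suc.prems] by (intro divide_right_mono) auto
    finally show ?case by simp
  qed
  have "(\<lambda>n. bhat_div s - agm_sum n s) \<longlonglongrightarrow> 0"
  proof (rule Lim_null_comparison)
    show "\<forall>\<^sub>F n in sequentially. norm (bhat_div s - agm_sum n s) \<le> s * (1 / 2) ^ n"
      using bound[OF that] by (simp add: power_divide)
    show "(\<lambda>n. s * (1 / 2) ^ n) \<longlonglongrightarrow> 0"
      by (rule tendsto_mult_right_zero, rule LIMSEQ_power_zero) simp
  qed
  then have "(\<lambda>n. bhat_div s - (bhat_div s - agm_sum n s)) \<longlonglongrightarrow> bhat_div s - 0"
    by (intro tendsto_diff tendsto_const)
  then show ?thesis by simp
qed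

lemma bhat_div_mono: "bhat_div s \<le> bhat_div t" if "0 \<le> s" "s \<le> t"
  using that by (intro LIMSEQ_le[OF agm_sum_tendsto agm_sum_tendsto]) (auto intro: agm_sum_mono)

lemma bhat_div_div_square_antimono: "bhat_div t / t\<^sup>2 \<le> bhat_div s / s\<^sup>2" if "0 < s" "s \<le> t"
  using that
  by (intro LIMSEQ_le[OF tendsto_divide[OF agm_sum_tendsto tendsto_const] tendsto_divide[OF agm_sum_tendsto tendsto_const]])
    (auto intro: agm_sum_div_square_antimono)

text \<open>The quotient \<open>sqrt (bhat_div u) / u\<close> is decreasing, so at \<open>s\<close>
  and at \<open>t\<close> it is at least its value \<open>m\<close> at \<open>s + t\<close>, and
  \<open>(s + t) * m\<close> splits into \<open>s * m\<close> and \<open>t * m\<close>.\<close>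

lemma sqrt_bhat_div_subadditive:
  "sqrt (bhat_div (s + t)) \<le> sqrt (bhat_div s) + sqrt (bhat_div t)" if "0 \<le> s" "0 \<le> t"
proof (cases "s = 0 \<or> t = 0")
  case True
  then show ?thesis by (auto simp: bhat_div_0)
next
  case False
  then have st: "0 < s" "0 < t" using that by auto
  define m where "m = sqrt (bhat_div (s + t)) / (s + t)"
  have m: "u * m \<le> sqrt (bhat_div u)" if "0 < u" "u \<le> s + t" for u
  proof -
    have "sqrt (bhat_div (s + t) / (s + t)\<^sup>2) \<le> sqrt (bhat_div u / u\<^sup>2)"
      using bhat_div_div_square_antimono[OF that] by simp
    then have "m \<le> sqrt (bhat_div u) / u" using that st by (simp add: m_def real_sqrt_divide)
    then show ?thesis using that by (simp add: field_simps)
  qed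
  have "sqrt (bhat_div (s + t)) = s * m + t * m"
    using st unfolding distrib_right[symmetric] by (simp add: m_def)
  then show ?thesis using m[of s] m[of t] st by linarith
qed

subsection \<open>The triangle inequality\<close>

text \<open>
  \<open>(A, B, C)\<close> are hyperboloid coordinates with apex \<open>\<phi>\<close>, so that Cauchy-Schwarz in the
  last two coordinates gives the claim.
\<close>

lemma cosh_dist_triangle:
  assumes "0 < Im \<theta>" "0 < Im \<phi>" "0 < Im \<psi>"
  shows "cosh_dist \<theta> \<psi> \<le> cosh_dist \<theta> \<phi> * cosh_dist \<phi> \<psi>
    + sqrt ((cosh_dist \<theta> \<phi>)\<^sup>2 - 1) * sqrt ((cosh_dist \<phi> \<psi>)\<^sup>2 - 1)"
proof -
  define y where "y = Im \<phi>"
  define A where "A = (\<lambda>\<zeta>. (y\<^sup>2 + (Im \<zeta>)\<^sup>2 + (Re \<zeta> - Re \<phi>)\<^sup>2) / (2 * y * Im \<zeta>))"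
  define B where "B = (\<lambda>\<zeta>. ((Re \<zeta> - Re \<phi>)\<^sup>2 + (Im \<zeta>)\<^sup>2 - y\<^sup>2) / (2 * y * Im \<zeta>))"
  define C where "C = (\<lambda>\<zeta>. (Re \<zeta> - Re \<phi>) / Im \<zeta>)"
  have y: "0 < y" using assms by (simp add: y_def)
  have A2: "(A \<zeta>)\<^sup>2 - 1 = (B \<zeta>)\<^sup>2 + (C \<zeta>)\<^sup>2" if "0 < Im \<zeta>" for \<zeta>
    using that y by (simp add: A_def B_def C_def field_simps power2_eq_square)
  have A: "cosh_dist \<theta> \<phi> = A \<theta>" "cosh_dist \<phi> \<psi> = A \<psi>"
    unfolding cosh_dist_def cmod_power2 A_def using assms y
    by (simp_all add: y_def[symmetric] field_simps power2_eq_square)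
  \<comment> \<open>This is the Minkowski product of the hyperboloid coordinates of the two
    points.\<close>
  moreover have "cosh_dist \<theta> \<psi> = A \<theta> * A \<psi> - (B \<theta> * B \<psi> + C \<theta> * C \<psi>)"
  proof -
    define p u where "p = Re \<theta> - Re \<phi>" and "u = Im \<theta>"
    define q v where "q = Re \<psi> - Re \<phi>" and "v = Im \<psi>"
    have uv: "0 < u" "0 < v" using assms by (simp_all add: u_def v_def)
    have "A \<theta> * A \<psi> - B \<theta> * B \<psi> = ((y\<^sup>2 + u\<^sup>2 + p\<^sup>2) * (y\<^sup>2 + v\<^sup>2 + q\<^sup>2)
        - (p\<^sup>2 + u\<^sup>2 - y\<^sup>2) * (q\<^sup>2 + v\<^sup>2 - y\<^sup>2)) / ((2 * y * u) * (2 * y * v))"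
      unfolding A_def B_def p_def q_def u_def v_def times_divide_times_eq
      by (rule diff_divide_distrib[symmetric])
    also have "(y\<^sup>2 + u\<^sup>2 + p\<^sup>2) * (y\<^sup>2 + v\<^sup>2 + q\<^sup>2) - (p\<^sup>2 + u\<^sup>2 - y\<^sup>2) * (q\<^sup>2 + v\<^sup>2 - y\<^sup>2)
        = 2 * y\<^sup>2 * (p\<^sup>2 + u\<^sup>2 + q\<^sup>2 + v\<^sup>2)"
      by (simp add: algebra_simps)
    also have "\<dots> / ((2 * y * u) * (2 * y * v)) = (p\<^sup>2 + u\<^sup>2 + q\<^sup>2 + v\<^sup>2) / (2 * u * v)"
      using y uv by (simp add: field_simps power2_eq_square)
    finally have "A \<theta> * A \<psi> - (B \<theta> * B \<psi> + C \<theta> * C \<psi>)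
        = (p\<^sup>2 + u\<^sup>2 + q\<^sup>2 + v\<^sup>2) / (2 * u * v) - p / u * (q / v)"
      by (simp add: C_def p_def q_def u_def v_def)
    also have "\<dots> = 1 + ((p - q)\<^sup>2 + (u - v)\<^sup>2) / (2 * u * v)"
      using uv by (simp add: field_simps power2_eq_square)
    finally show ?thesis
      by (simp add: cosh_dist_def cmod_power2 p_def q_def u_def v_def)
  qed
  moreover have "- (B \<theta> * B \<psi> + C \<theta> * C \<psi>) \<le> norm (B \<theta>, C \<theta>) * norm (B \<psi>, C \<psi>)"
    using Cauchy_Schwarz_ineq2[of "(B \<theta>, C \<theta>)" "(B \<psi>, C \<psi>)"] by (simp add: inner_Pair)
  ultimately show ?thesis by (simp add: A2 assms norm_Pair)
qed

text \<open>Half the hyperbolic distance, to match \<open>bhat_geodesic s\<close>, which belongs to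
  distance \<open>2 * s\<close>.\<close>

definition half_dist :: "complex \<Rightarrow> complex \<Rightarrow> real" where
  "half_dist \<theta> \<phi> = arcosh (cosh_dist \<theta> \<phi>) / 2"

lemma half_dist:
  assumes "0 < Im \<theta>" "0 < Im \<phi>"
  shows "0 \<le> half_dist \<theta> \<phi>" "cosh (2 * half_dist \<theta> \<phi>) = cosh_dist \<theta> \<phi>"
    "sinh (2 * half_dist \<theta> \<phi>) = sqrt ((cosh_dist \<theta> \<phi>)\<^sup>2 - 1)"
  using cosh_dist_ge_1[OF assms] by (simp_all add: half_dist_def sinh_arcosh_real)

text \<open>The right side of the bound on \<open>cosh_dist\<close> is the addition formula for
  \<open>cosh\<close>, which is increasing on nonnegative arguments.\<close>

lemma half_dist_triangle:
  assumes "0 < Im \<theta>" "0 < Im \<phi>" "0 < Im \<psi>"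
  shows "half_dist \<theta> \<psi> \<le> half_dist \<theta> \<phi> + half_dist \<phi> \<psi>"
proof -
  note h = half_dist[OF assms(1,2)] half_dist[OF assms(2,3)] half_dist[OF assms(1,3)]
  have "cosh (2 * half_dist \<theta> \<psi>) \<le> cosh (2 * half_dist \<theta> \<phi> + 2 * half_dist \<phi> \<psi>)"
    unfolding cosh_add h by (rule cosh_dist_triangle[OF assms])
  then show ?thesis
    using h cosh_real_nonneg_le_iff[of "2 * half_dist \<theta> \<psi>" "2 * half_dist \<theta> \<phi> + 2 * half_dist \<phi> \<psi>"] by simp
qed

section \<open>The divergence of Cauchy densities and its symmetries\<close>

lemma bhattacharyya_divergence_cauchy:
  assumes "0 < Im \<theta>" "0 < Im \<phi>"
  shows "bhattacharyya_divergence (cauchy_density \<theta>) (cauchy_density \<phi>) = bhat_div (half_dist \<theta> \<phi>)"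
  unfolding bhattacharyya_divergence_def bhat_div_def bhat_geodesic_def half_dist(2)[OF assms]
    bhattacharyya_coefficient_cauchy(2)[OF assms] ..

text \<open>The real \<open>sqrt\<close> is odd, so the integral only changes its sign, which
  \<open>ln\<close> ignores.\<close>

lemma bhattacharyya_divergence_uminus:
  "bhattacharyya_divergence (\<lambda>x. - p x) q = bhattacharyya_divergence p q"
  by (simp add: bhattacharyya_divergence_def real_sqrt_minus ln_minus)

lemma bhattacharyya_divergence_commute:
  "bhattacharyya_divergence p q = bhattacharyya_divergence q p"
  by (simp add: bhattacharyya_divergence_def mult.commute)

text \<open>
  \<^const>\<open>Metric_space\<close> requires nonnegativity on the whole type. Outside the upper half plane it
  holds since \<^const>\<open>ln\<close> is even on the reals and vanishes at \<open>0\<close>.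
\<close>

lemma cauchy_density_cnj: "cauchy_density (cnj \<theta>) = (\<lambda>x. - cauchy_density \<theta> x)"
  by (rule ext) (simp add: cauchy_density_def, metis complex_cnj_complex_of_real complex_cnj_diff complex_mod_cnj)

lemma bhattacharyya_divergence_cnj:
  "bhattacharyya_divergence (cauchy_density (cnj \<theta>)) q = bhattacharyya_divergence (cauchy_density \<theta>) q"
  unfolding cauchy_density_cnj by (rule bhattacharyya_divergence_uminus)

lemma bhattacharyya_divergence_cauchy_nonneg:
  "0 \<le> bhattacharyya_divergence (cauchy_density \<theta>) (cauchy_density \<phi>)"
proof -
  \<comment> \<open>Conjugation moves a parameter into the closed upper half plane without changing
    the divergence.\<close>
  define up where "up = (\<lambda>\<theta>. if Im \<theta> < 0 then cnj \<theta> else \<theta>)"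
  let ?D = "\<lambda>\<theta> \<phi>. bhattacharyya_divergence (cauchy_density \<theta>) (cauchy_density \<phi>)"
  have up: "?D (up \<theta>) \<phi> = ?D \<theta> \<phi>" for \<theta> \<phi> by (simp add: up_def bhattacharyya_divergence_cnj)
  have "?D \<theta> \<phi> = ?D (up \<theta>) (up \<phi>)"
    using up bhattacharyya_divergence_commute by metis
  also have "0 \<le> \<dots>"
  proof (cases "Im \<theta> = 0 \<or> Im \<phi> = 0")
    \<comment> \<open>A density with parameter on the real axis vanishes identically, so the
      integral is 0 and the divergence takes the default value \<open>- ln 0 = 0\<close>.\<close>
    case True
    then have "Im (up \<theta>) = 0 \<or> Im (up \<phi>) = 0" by (auto simp: up_def)
    then show ?thesis by (auto simp: bhattacharyya_divergence_def cauchy_density_def)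
  next
    case False
    then have "0 < Im (up \<theta>)" "0 < Im (up \<phi>)" by (auto simp: up_def)
    then show ?thesis by (simp add: bhattacharyya_divergence_cauchy bhat_div_nonneg half_dist)
  qed
  finally show ?thesis .
qed

theorem theorem9:
  shows "Metric_space upper_half_plane
    (\<lambda>\<theta>\<^sub>1 \<theta>\<^sub>2. sqrt (bhattacharyya_divergence (cauchy_density \<theta>\<^sub>1) (cauchy_density \<theta>\<^sub>2)))"
proof
  fix \<theta> \<phi> :: complex
  show "0 \<le> sqrt (bhattacharyya_divergence (cauchy_density \<theta>) (cauchy_density \<phi>))"
    by (simp add: bhattacharyya_divergence_cauchy_nonneg)
  show "sqrt (bhattacharyya_divergence (cauchy_density \<theta>) (cauchy_density \<phi>)) =
      sqrt (bhattacharyya_divergence (cauchy_density \<phi>) (cauchy_density \<theta>))"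
    by (subst bhattacharyya_divergence_commute) (rule refl)
next
  fix \<theta> \<phi> assume "\<theta> \<in> upper_half_plane" "\<phi> \<in> upper_half_plane"
  then have im: "0 < Im \<theta>" "0 < Im \<phi>" by (auto simp: upper_half_plane_def)
  have "bhat_div (half_dist \<theta> \<phi>) = 0 \<longleftrightarrow> half_dist \<theta> \<phi> = 0"
    using bhat_div_pos[of "half_dist \<theta> \<phi>"] half_dist[OF im] bhat_div_0 by force
  also have "\<dots> \<longleftrightarrow> cosh_dist \<theta> \<phi> = 1"
    using half_dist[OF im] cosh_real_one_iff[of "2 * half_dist \<theta> \<phi>"] by simp
  also have "\<dots> \<longleftrightarrow> \<theta> = \<phi>" using im by (simp add: cosh_dist_def)
  finally show "sqrt (bhattacharyya_divergence (cauchy_density \<theta>) (cauchy_density \<phi>)) = 0 \<longleftrightarrow> \<theta> = \<phi>"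
    by (simp add: bhattacharyya_divergence_cauchy[OF im])
next
  fix \<theta> \<phi> \<psi> assume "\<theta> \<in> upper_half_plane" "\<phi> \<in> upper_half_plane" "\<psi> \<in> upper_half_plane"
  then have im: "0 < Im \<theta>" "0 < Im \<phi>" "0 < Im \<psi>" by (auto simp: upper_half_plane_def)
  have "sqrt (bhat_div (half_dist \<theta> \<psi>)) \<le> sqrt (bhat_div (half_dist \<theta> \<phi> + half_dist \<phi> \<psi>))"
    using half_dist_triangle[OF im] half_dist(1)[OF im(1,3)] by (simp add: bhat_div_mono)
  also have "\<dots> \<le> sqrt (bhat_div (half_dist \<theta> \<phi>)) + sqrt (bhat_div (half_dist \<phi> \<psi>))"
    using im by (intro sqrt_bhat_div_subadditive half_dist)
  finally show "sqrt (bhattacharyya_divergence (cauchy_density \<theta>) (cauchy_density \<psi>))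
      \<le> sqrt (bhattacharyya_divergence (cauchy_density \<theta>) (cauchy_density \<phi>))
        + sqrt (bhattacharyya_divergence (cauchy_density \<phi>) (cauchy_density \<psi>))"
    by (simp add: bhattacharyya_divergence_cauchy im)
qed

end
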